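(* For any $\rho>0$ there exists a $\rho$-negative comonotone single-valued operator $F:\mathbb{R}^d\to\mathbb{R}^d$ such that, for any $0<\gamma\le2\rho$, the Proximal Point method with stepsize $\gamma$ does not converge to the solution of the problem of finding $x^*$ with $F(x^* )=0$. In particular, one can take $F(x)=-x/\rho$.
   Context: A single-valued operator $F:\mathbb{R}^d\to\mathbb{R}^d$ ($d\ge1$) is $\rho$-negative comonotone if $\langle F(x)-F(y),x-y\rangle\ge-\rho\|F(x)-F(y)\|^2$ for all $x,y\in\mathbb{R}^d$. The Proximal Point method with stepsize $\gamma$ generates from $x^0$ the sequence defined implicitly by $x^{k+1}=x^k-\gamma F(x^{k+1})$, $k\ge0$. "Does not converge to the solution" means: when started at a point $x^0$ that is not a solution, either some iterate is undefined (the implicit equation has no solution) or the iterates do not converge to a solution. *)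

theory Defs
  imports "HOL-Analysis.Analysis"
begin

definition negative_comonotone :: "real \<Rightarrow> ('a::real_inner \<Rightarrow> 'a) \<Rightarrow> bool" where
  "negative_comonotone \<rho> F \<longleftrightarrow>
     (\<forall>x y. (F x - F y) \<bullet> (x - y) \<ge> - \<rho> * (norm (F x - F y))\<^sup>2)"

definition prox_point_step :: "('a::real_vector \<Rightarrow> 'a) \<Rightarrow> real \<Rightarrow> 'a \<Rightarrow> 'a \<Rightarrow> bool" where
  "prox_point_step F \<gamma> u v \<longleftrightarrow> v = u - \<gamma> *\<^sub>R F v"

text \<open>The step is implicit, so it may have no solution, or several. A run is therefore a
  sequence of optional points: \<open>None\<close> marks an undefined iterate, and it may occur only if the
  implicit equation is unsolvable or an earlier iterate is already undefined. If the equation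
  has several solutions, any of them may be the next iterate. A run exists from every
  starting point.\<close>

definition prox_point_run ::
    "('a::real_vector \<Rightarrow> 'a) \<Rightarrow> real \<Rightarrow> 'a \<Rightarrow> (nat \<Rightarrow> 'a option) \<Rightarrow> bool" where
  "prox_point_run F \<gamma> x0 x \<longleftrightarrow>
     x 0 = Some x0 \<and>
     (\<forall>k. case x k of
            None \<Rightarrow> x (Suc k) = None
          | Some u \<Rightarrow> (case x (Suc k) of
                None \<Rightarrow> \<not> (\<exists>v. prox_point_step F \<gamma> u v)
              | Some v \<Rightarrow> prox_point_step F \<gamma> u v))"

definition prox_point_not_convergent ::
    "('a::real_normed_vector \<Rightarrow> 'a) \<Rightarrow> real \<Rightarrow> bool" where
  "prox_point_not_convergent F \<gamma> \<longleftrightarrow>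
     (\<forall>x0 x. F x0 \<noteq> 0 \<longrightarrow> prox_point_run F \<gamma> x0 x \<longrightarrow>
        (\<exists>k. x k = None) \<or>
        \<not> (\<exists>xs. F xs = 0 \<and> (\<lambda>k. the (x k)) \<longlonglongrightarrow> xs))"

end

theory Submission
  imports Defs
begin

text \<open>Take \<open>F x = - x / \<rho>\<close>. Both sides of the comonotonicity inequality then equal
  \<open>- \<parallel>x - y\<parallel>\<^sup>2 / \<rho>\<close>. The implicit step reads \<open>(1 - \<gamma> / \<rho>) v = u\<close>, and the stepsize range
  \<open>0 < \<gamma> \<le> 2 \<rho>\<close> gives \<open>\<bar>1 - \<gamma> / \<rho>\<bar> \<le> 1\<close>: every step that can be taken moves to a point
  at least as far from the origin as the current one. A run whose iterates all exist thus never
  gets closer to the only solution, the origin, than its nonzero starting point. For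
  \<open>\<gamma> = \<rho>\<close> the step cannot be taken at all from a nonzero point.\<close>

lemma negative_comonotone_neg_scale:
  assumes "\<rho> > 0"
  shows "negative_comonotone \<rho> (\<lambda>x::'a::real_inner. - (x /\<^sub>R \<rho>))"
proof -
  have "(- (x /\<^sub>R \<rho>) - - (y /\<^sub>R \<rho>)) \<bullet> (x - y)
      = - \<rho> * (norm (- (x /\<^sub>R \<rho>) - - (y /\<^sub>R \<rho>)))\<^sup>2" for x y :: 'a
  proof -
    have diff: "- (x /\<^sub>R \<rho>) - - (y /\<^sub>R \<rho>) = (- inverse \<rho>) *\<^sub>R (x - y)"
      by (simp add: algebra_simps)
    show ?thesis
      unfolding diff inner_scaleR_left norm_scaleR power_mult_distrib power2_norm_eq_inner
      using assms by (simp add: power2_eq_square)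
  qed
  then show ?thesis
    by (simp add: negative_comonotone_def)
qed

lemma prox_point_step_neg_scale_norm_le:
  fixes u v :: "'a::real_normed_vector"
  assumes "\<rho> > 0" "0 < \<gamma>" "\<gamma> \<le> 2 * \<rho>"
    and step: "prox_point_step (\<lambda>x. - (x /\<^sub>R \<rho>)) \<gamma> u v"
  shows "norm u \<le> norm v"
proof -
  have "u = (1 - \<gamma> / \<rho>) *\<^sub>R v"
    using step by (simp add: prox_point_step_def algebra_simps divide_inverse)
  moreover have "\<bar>1 - \<gamma> / \<rho>\<bar> \<le> 1"
    using assms(1-3) by (simp add: abs_le_iff field_simps)
  ultimately show ?thesis
    by (simp add: mult_left_le_one_le)
qed

text \<open>The norm of the starting point is a lower bound for the norms of all later iterates, hence
  for the norm of their limit, which therefore cannot be the origin, the only zero of \<open>F\<close>.\<close>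

lemma prox_point_not_convergent_if_norm_nondecreasing:
  fixes F :: "'a::real_normed_vector \<Rightarrow> 'a"
  assumes zero_iff: "\<And>x. F x = 0 \<longleftrightarrow> x = 0"
    and step_norm: "\<And>u v. prox_point_step F \<gamma> u v \<Longrightarrow> norm u \<le> norm v"
  shows "prox_point_not_convergent F \<gamma>"
  unfolding prox_point_not_convergent_def
proof (intro allI impI)
  fix x0 x
  assume "F x0 \<noteq> 0" and run: "prox_point_run F \<gamma> x0 x"
  show "(\<exists>k. x k = None) \<or> \<not> (\<exists>xs. F xs = 0 \<and> (\<lambda>k. the (x k)) \<longlonglongrightarrow> xs)"
  proof (rule ccontr)
    assume "\<not> ?thesis"
    then obtain xs where total: "\<forall>k. x k \<noteq> None" and "F xs = 0"
      and lim: "(\<lambda>k. the (x k)) \<longlonglongrightarrow> xs"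
      by (auto simp only: de_Morgan_disj not_not not_ex)
    have "norm (the (x k)) \<le> norm (the (x (Suc k)))" for k
    proof -
      obtain u v where uv: "x k = Some u" "x (Suc k) = Some v"
        using total by blast
      then have "prox_point_step F \<gamma> u v"
        using run by (auto simp: prox_point_run_def dest!: spec[where x = k])
      then show ?thesis
        using step_norm uv by simp
    qed
    then have "incseq (\<lambda>k. norm (the (x k)))"
      by (rule incseq_SucI)
    then have "norm (the (x 0)) \<le> norm xs"
      using tendsto_norm[OF lim] by (rule incseq_le)
    then have "norm x0 \<le> norm xs"
      using run by (simp add: prox_point_run_def)
    with \<open>F x0 \<noteq> 0\<close> \<open>F xs = 0\<close> show False
      by (simp add: zero_iff)
  qed
qed

theorem theorem3p3:
  fixes \<rho> :: real
  assumes "\<rho> > 0"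
  shows "(\<exists>F :: real ^ 'n \<Rightarrow> real ^ 'n.
            negative_comonotone \<rho> F \<and>
            (\<exists>!xs. F xs = 0) \<and>
            (\<forall>\<gamma>. 0 < \<gamma> \<and> \<gamma> \<le> 2 * \<rho> \<longrightarrow> prox_point_not_convergent F \<gamma>)) \<and>
         (let F = (\<lambda>x :: real ^ 'n. - (x /\<^sub>R \<rho>)) in
            negative_comonotone \<rho> F \<and>
            (\<exists>!xs. F xs = 0) \<and>
            (\<forall>\<gamma>. 0 < \<gamma> \<and> \<gamma> \<le> 2 * \<rho> \<longrightarrow> prox_point_not_convergent F \<gamma>))"
proof -
  let ?F = "\<lambda>x :: real ^ 'n. - (x /\<^sub>R \<rho>)"
  have zero_iff: "?F x = 0 \<longleftrightarrow> x = 0" for x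
    using assms by simp
  have "prox_point_not_convergent ?F \<gamma>" if "0 < \<gamma> \<and> \<gamma> \<le> 2 * \<rho>" for \<gamma>
    using prox_point_step_neg_scale_norm_le[OF assms] that zero_iff
    by (blast intro: prox_point_not_convergent_if_norm_nondecreasing)
  moreover have "\<exists>!xs. ?F xs = 0"
    unfolding zero_iff by simp
  ultimately have example: "negative_comonotone \<rho> ?F \<and> (\<exists>!xs. ?F xs = 0) \<and>
      (\<forall>\<gamma>. 0 < \<gamma> \<and> \<gamma> \<le> 2 * \<rho> \<longrightarrow> prox_point_not_convergent ?F \<gamma>)"
    using negative_comonotone_neg_scale[OF assms] by blast
  show ?thesis
    unfolding Let_def
    by (rule conjI, rule exI[where x = ?F], rule example, rule example)
qed

end
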